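(* Let $\mu\in\mathbb C$ and $k,k'\in\mathbb N$, with $\mu+k+\frac12\neq0$ and $\Re\mu>-1$. Then $$\int_{-1}^{1}{\sf P}_{k+\mu}^{-\mu}(x)\,{\sf P}_{k'+\mu}^{-\mu}(x)\,\mathrm dx=\frac{k!}{\Gamma(2\mu+k+1)\,(\mu+k+\frac12)}\,\delta_{k,k'}.$$
   Context: $\mathbb N=\{1,2,3,\ldots\}$, and $\delta_{k,k'}$ is the Kronecker delta. The Ferrers function of the first kind is, for $\nu,\mu\in\mathbb C$ and $x\in(-1,1)$, $${\sf P}_\nu^{-\mu}(x)=\frac{1}{\Gamma(\mu+1)}\left(\frac{1-x}{1+x}\right)^{\frac{\mu}{2}}{}_2F_1\left(-\nu,\nu+1;\mu+1;\frac{1-x}{2}\right),$$ where ${}_2F_1(a,b;c;z)=\sum_{j\ge0}\frac{(a)_j(b)_j}{(c)_j}\frac{z^j}{j!}$ is the Gauss hypergeometric series, $(a)_0=1$, $(a)_j=a(a+1)\cdots(a+j-1)$. No complex conjugation is taken in the integrand. *)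

theory Defs
  imports "HOL-Analysis.Analysis"
begin

definition hypergeo_2F1 :: "complex \<Rightarrow> complex \<Rightarrow> complex \<Rightarrow> complex \<Rightarrow> complex" where
  "hypergeo_2F1 a b c z =
     (\<Sum>j. pochhammer a j * pochhammer b j / pochhammer c j * (z ^ j / fact j))"

lemma hypergeo_2F1_eq_eval_fps:
  "hypergeo_2F1 a b c z = eval_fps (fps_hypergeo [a, b] [c] 1) z"
  by (simp add: hypergeo_2F1_def eval_fps_def)

(* Ferrers_P nu m x is the Ferrers function of the first kind with degree nu and order
   (upper index) m; the formula is the usual one for order -mu, with mu = -m.
   It is meant for -1 < x < 1, where the base of the power is a positive real (so powr is the
   principal value) and the argument (1 - x)/2 lies in the disc of convergence.  For m a
   positive integer the series has zero denominators and would need regularising. *)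
definition Ferrers_P :: "complex \<Rightarrow> complex \<Rightarrow> real \<Rightarrow> complex" where
  "Ferrers_P \<nu> m x =
     1 / Gamma (- m + 1) * complex_of_real ((1 - x) / (1 + x)) powr (- m / 2) *
     hypergeo_2F1 (- \<nu>) (\<nu> + 1) (- m + 1) (complex_of_real ((1 - x) / 2))"

end

theory Submission
  imports Defs
begin

text \<open>
  Write \<open>z = (1 - x) / 2\<close>. Euler's transformation
  \<open>F(a, b; c; z) = (1 - z)\<^sup>c\<^sup>-\<^sup>a\<^sup>-\<^sup>b F(c - a, c - b; c; z)\<close>, applied with \<open>a = -k - \<mu>\<close>, \<open>b = k + \<mu> + 1\<close> and
  \<open>c = \<mu> + 1\<close>, has exponent \<open>c - a - b = \<mu>\<close> and turns the hypergeometric series in the Ferrers function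
  into a terminating one: the Ferrers function of degree \<open>k + \<mu>\<close> and order \<open>-\<mu>\<close> equals
  \<open>(z / (1 - z))\<^bsup>\<mu>/2\<^esup> (1 - z)\<^bsup>\<mu>\<^esup> q\<^sub>k(z) / \<Gamma>(\<mu> + 1)\<close> for a polynomial \<open>q\<^sub>k\<close> of degree at most \<open>k\<close>,
  a Gegenbauer polynomial up to normalisation. A product of two such functions is therefore
  \<open>z\<^bsup>\<mu>\<^esup> (1 - z)\<^bsup>\<mu>\<^esup> q\<^sub>k(z) q\<^sub>l(z) / \<Gamma>(\<mu> + 1)\<^sup>2\<close>, and the claim amounts to
  the orthogonality of the \<open>q\<^sub>k\<close> for a complex Beta weight on the unit interval, together with the
  integrals of their squares.

  The orthogonality follows from the moments against powers of \<open>1 - z\<close>. The terms of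
  \<open>\<integral> z\<^bsup>\<mu>\<^esup> (1 - z)\<^bsup>\<mu> + m\<^esup> q\<^sub>k(z) dz\<close> are Beta integrals, and the resulting sum is evaluated by the
  Chu-Vandermonde identity; it contains the factor \<open>(m + 1 - k)\<^sub>k\<close>, which vanishes for
  \<open>m < k\<close> (lemma \<open>integral_beta_kernel_gegenbauer\<close>). Expanding the other polynomial in powers of \<open>1 - z\<close>
  leaves only its coefficient of degree \<open>k\<close> (lemma \<open>integral_gegenbauer_mult_poly\<close>), which is zero
  when that polynomial has smaller degree and gives the square integral when it is \<open>q\<^sub>k\<close> itself.

  Two classical facts carry this. The Beta integral with complex parameters is obtained by applying Fubini's
  theorem to the convolution of two Gamma integrands (theorem \<open>has_bochner_integral_beta_kernel\<close>).
  Euler's transformation is an identity of formal power series: both sides solve the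
  hypergeometric differential equation, whose power series solutions are determined by their constant
  term (theorem \<open>fps_hypergeo_Euler\<close>).
\<close>

section \<open>The Beta integral with complex parameters\<close>

lemma Re_pos_not_nonpos_Int: "Re z > 0 \<Longrightarrow> z \<notin> \<int>\<^sub>\<le>\<^sub>0"
  by (auto elim!: nonpos_Ints_cases)

text \<open>The integrand of the Gamma integral, extended by zero to the whole real line so that it can be convolved.\<close>

definition gamma_kernel :: "complex \<Rightarrow> real \<Rightarrow> complex" where
  "gamma_kernel a t = indicator {0<..} t *\<^sub>R (of_real t powr (a - 1) / of_real (exp t))"

lemma has_bochner_integral_gamma_kernel:
  assumes "Re a > 0"
  shows "has_bochner_integral lborel (gamma_kernel a) (Gamma a)"
proof -
  have m: "set_borel_measurable borel {0<..} (\<lambda>t. complex_of_real t powr (a - 1) / of_real (exp t))"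
    by (intro set_measurable_continuous_on continuous_intros) (auto simp: complex_nonpos_Reals_iff)
  have i: "set_integrable lebesgue {0<..} (\<lambda>t. complex_of_real t powr (a - 1) / of_real (exp t))"
    by (rule absolutely_integrable_Gamma_integral'[OF assms])
  hence i': "set_integrable lborel {0<..} (\<lambda>t. complex_of_real t powr (a - 1) / of_real (exp t))"
    using m unfolding set_integrable_def set_borel_measurable_def by (subst (asm) integrable_completion) auto
  have "(LINT t:{0<..}|lborel. complex_of_real t powr (a - 1) / of_real (exp t)) = Gamma a"
    using set_borel_integral_eq_integral(2)[OF i'] Gamma_integral_complex'[OF assms]
    by (simp add: has_integral_iff)
  with i' show ?thesis
    by (simp add: has_bochner_integral_iff set_integrable_def set_lebesgue_integral_def gamma_kernel_def[abs_def])
qed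

text \<open>The integrand of the Beta integral, extended by zero outside the open unit interval.\<close>

definition beta_kernel :: "complex \<Rightarrow> complex \<Rightarrow> real \<Rightarrow> complex" where
  "beta_kernel a b t = indicator {0<..<1} t *\<^sub>R (of_real t powr (a - 1) * of_real (1 - t) powr (b - 1))"

lemma integrable_beta_kernel:
  assumes "Re a > 0" "Re b > 0"
  shows "integrable lborel (beta_kernel a b)"
proof (rule Bochner_Integration.integrable_bound)
  show "integrable lborel (\<lambda>t. indicator {0..1} t *\<^sub>R (t powr (Re a - 1) * (1 - t) powr (Re b - 1)))"
    using integrable_Beta[OF assms] by (simp add: set_integrable_def)
  have "set_borel_measurable borel {0<..<1}
      (\<lambda>t. of_real t powr (a - 1) * complex_of_real (1 - t) powr (b - 1))"
    by (intro set_measurable_continuous_on continuous_intros) (auto simp: complex_nonpos_Reals_iff)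
  thus "beta_kernel a b \<in> borel_measurable lborel"
    by (simp add: set_borel_measurable_def beta_kernel_def[abs_def])
qed (auto simp: beta_kernel_def indicator_def norm_mult norm_powr_real_powr simp del: of_real_diff intro!: AE_I2)

text \<open>
  The integrand of the convolution of two Gamma kernels at \<open>s\<close>, after the substitution
  \<open>x = s t\<close>, separates into a Gamma kernel in \<open>s\<close> and a Beta kernel in \<open>t\<close>.
\<close>

lemma gamma_kernel_mult:
  assumes "s > 0"
  shows "gamma_kernel a (s * t) * gamma_kernel b (s - s * t) * of_real s
           = gamma_kernel (a + b) s * beta_kernel a b t"
proof (cases "0 < t \<and> t < 1")
  case True
  have 1: "complex_of_real (s * t) powr (a - 1) = of_real s powr (a - 1) * of_real t powr (a - 1)"
    unfolding of_real_mult using assms True by (intro powr_times_real) auto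
  have "complex_of_real (s * (1 - t)) powr (b - 1) = of_real s powr (b - 1) * of_real (1 - t) powr (b - 1)"
    unfolding of_real_mult using assms True by (intro powr_times_real) auto
  moreover have "s - s * t = s * (1 - t)" by (simp add: algebra_simps)
  ultimately have 2: "complex_of_real (s - s * t) powr (b - 1) = of_real s powr (b - 1) * of_real (1 - t) powr (b - 1)"
    by simp
  have 3: "complex_of_real s powr (a + b - 1) = of_real s powr (a - 1) * of_real s powr (b - 1) * of_real s"
    using assms by (simp add: powr_add powr_diff)
  have 4: "complex_of_real (exp s) = of_real (exp (s * t)) * of_real (exp (s - s * t))"
    by (simp flip: exp_add exp_of_real)
  have p: "s * t > 0" "s * t < s" using assms True by auto
  show ?thesis
    using assms True p
    by (simp add: gamma_kernel_def beta_kernel_def 1 2 3 4 mult_ac del: of_real_mult of_real_diff)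
next
  case False
  hence "\<not> (0 < s * t \<and> s * t < s)" using assms by (auto simp: zero_less_mult_iff)
  with False show ?thesis by (auto simp: gamma_kernel_def beta_kernel_def)
qed

theorem has_bochner_integral_beta_kernel:
  assumes a: "Re a > 0" and b: "Re b > 0"
  shows "has_bochner_integral lborel (beta_kernel a b) (Beta a b)"
proof -
  have [measurable]: "gamma_kernel a \<in> borel_measurable borel" "gamma_kernel b \<in> borel_measurable borel"
    using has_bochner_integral_gamma_kernel[OF a] has_bochner_integral_gamma_kernel[OF b]
    by (auto simp: has_bochner_integral_iff dest: borel_measurable_integrable)
  have ia: "integrable lborel (gamma_kernel a)" and ib: "integrable lborel (gamma_kernel b)"
    using has_bochner_integral_gamma_kernel[OF a] has_bochner_integral_gamma_kernel[OF b]
    by (auto simp: has_bochner_integral_iff)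
  have shift: "integral\<^sup>L lborel (\<lambda>s. f (s - x)) = integral\<^sup>L lborel f" 
    for f :: "real \<Rightarrow> 'c::{banach,second_countable_topology}" and x
    using lborel_integral_real_affine[of 1 f "-x"] by (simp add: add.commute)
  have shifti: "integrable lborel (\<lambda>s. gamma_kernel b (s - x))" for x
    using lborel_integrable_real_affine[OF ib, of 1 "-x"] by (simp add: add.commute)
  have int: "integrable (lborel \<Otimes>\<^sub>M lborel) (case_prod (\<lambda>x s. gamma_kernel a x * gamma_kernel b (s - x)))"
  proof (rule lborel_pair.Fubini_integrable)
    show "integrable lborel (\<lambda>x. \<integral>s. norm (case (x, s) of (x, s) \<Rightarrow> gamma_kernel a x * gamma_kernel b (s - x)) \<partial>lborel)"
      using ia by (simp add: norm_mult shift[of "\<lambda>y. norm (gamma_kernel b y)"])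
  qed (auto intro!: integrable_mult_right shifti)
  \<comment> \<open>The double integral of \<open>gamma_kernel a x * gamma_kernel b (s - x)\<close> is computed in both orders.\<close>
  have "Gamma a * Gamma b = (\<integral>x. gamma_kernel a x * Gamma b \<partial>lborel)"
    using has_bochner_integral_gamma_kernel[OF a] by (simp add: has_bochner_integral_iff)
  also have "\<dots> = (\<integral>x. (\<integral>s. gamma_kernel a x * gamma_kernel b (s - x) \<partial>lborel) \<partial>lborel)"
    using has_bochner_integral_gamma_kernel[OF b] 
    by (simp add: has_bochner_integral_iff shift[of "\<lambda>y. gamma_kernel b y"])
  also have "\<dots> = (\<integral>s. (\<integral>x. gamma_kernel a x * gamma_kernel b (s - x) \<partial>lborel) \<partial>lborel)"
    by (rule lborel_pair.Fubini_integral[OF int, symmetric])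
  also have "\<dots> = (\<integral>s. gamma_kernel (a + b) s * integral\<^sup>L lborel (beta_kernel a b) \<partial>lborel)"
  proof (rule Bochner_Integration.integral_cong[OF refl])
    fix s :: real
    show "(\<integral>x. gamma_kernel a x * gamma_kernel b (s - x) \<partial>lborel)
            = gamma_kernel (a + b) s * integral\<^sup>L lborel (beta_kernel a b)"
    proof (cases "s > 0")
      case True
      have "(\<integral>x. gamma_kernel a x * gamma_kernel b (s - x) \<partial>lborel)
          = (\<integral>t. gamma_kernel a (s * t) * gamma_kernel b (s - s * t) * of_real s \<partial>lborel)"
        using True
        by (subst lborel_integral_real_affine[of s _ 0]) (simp_all add: scaleR_conv_of_real mult_ac)
      thus ?thesis
        by (simp only: gamma_kernel_mult[OF True] integral_mult_right_zero)
    next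
      case False
      hence "gamma_kernel a x * gamma_kernel b (s - x) = 0" for x
        by (auto simp: gamma_kernel_def indicator_def)
      moreover have "gamma_kernel (a + b) s = 0" using False by (simp add: gamma_kernel_def)
      ultimately show ?thesis by (simp only: Bochner_Integration.integral_zero mult_zero_left)
    qed
  qed
  also have "\<dots> = Gamma (a + b) * integral\<^sup>L lborel (beta_kernel a b)"
    using has_bochner_integral_gamma_kernel[of "a + b"] a b by (simp add: has_bochner_integral_iff)
  finally have "Gamma a * Gamma b = Gamma (a + b) * integral\<^sup>L lborel (beta_kernel a b)" .
  moreover have "Gamma (a + b) \<noteq> 0"
    using a b by (simp add: Gamma_eq_zero_iff Re_pos_not_nonpos_Int)
  ultimately have "integral\<^sup>L lborel (beta_kernel a b) = Beta a b"
    by (simp add: Beta_def field_simps)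
  with integrable_beta_kernel[OF assms] show ?thesis by (simp add: has_bochner_integral_iff)
qed

section \<open>Euler's transformation of the hypergeometric series\<close>

text \<open>
  The hypergeometric differential operator
  \<open>X (1 - X) D\<^sup>2 + (c - (a + b + 1) X) D - a b\<close> on formal power series.
\<close>

definition hypergeo_op :: "complex \<Rightarrow> complex \<Rightarrow> complex \<Rightarrow> complex fps \<Rightarrow> complex fps" where
  "hypergeo_op a b c f = fps_X * (1 - fps_X) * fps_deriv (fps_deriv f)
     + (fps_const c - fps_const (a + b + 1) * fps_X) * fps_deriv f - fps_const (a * b) * f"

lemma hypergeo_op_nth:
  "fps_nth (hypergeo_op a b c f) n
     = of_nat (Suc n) * (of_nat n + c) * fps_nth f (Suc n) - (of_nat n + a) * (of_nat n + b) * fps_nth f n"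
proof -
  have eq: "hypergeo_op a b c f = fps_X * fps_deriv (fps_deriv f) - fps_X * (fps_X * fps_deriv (fps_deriv f))
    + fps_const c * fps_deriv f - fps_const (a + b + 1) * (fps_X * fps_deriv f) - fps_const (a * b) * f"
    by (simp add: hypergeo_op_def algebra_simps)
  show ?thesis
    unfolding eq by (cases n; cases "n - 1") (auto simp: algebra_simps)
qed

lemma hypergeo_op_fps_hypergeo:
  assumes c: "c \<notin> \<int>\<^sub>\<le>\<^sub>0"
  shows "hypergeo_op a b c (fps_hypergeo [a, b] [c] 1) = 0"
proof (rule fps_ext)
  fix n
  have "c + of_nat n \<noteq> 0" "pochhammer c n \<noteq> 0"
    using c by (auto simp: pochhammer_eq_0_iff dest: plus_of_nat_eq_0_imp)
  moreover have "fact n + fact n * of_nat n \<noteq> (0 :: complex)"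
    using fact_nonzero[of "Suc n", where 'a = complex] by (simp add: algebra_simps)
  ultimately show "fps_nth (hypergeo_op a b c (fps_hypergeo [a, b] [c] 1)) n = fps_nth 0 n"
    by (simp add: hypergeo_op_nth pochhammer_Suc divide_simps) (simp add: algebra_simps)
qed

lemma hypergeo_op_unique:
  assumes c: "c \<notin> \<int>\<^sub>\<le>\<^sub>0" and f: "hypergeo_op a b c f = 0" and g: "hypergeo_op a b c g = 0" 
    and 0: "fps_nth f 0 = fps_nth g 0"
  shows "f = g"
proof (rule fps_ext)
  fix n show "fps_nth f n = fps_nth g n"
  proof (induction n)
    case (Suc n)
    have "of_nat (Suc n) * (of_nat n + c) \<noteq> 0"
      using c plus_of_nat_eq_0_imp[of c n] by (auto simp: add.commute simp del: of_nat_Suc)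
    moreover have "of_nat (Suc n) * (of_nat n + c) * fps_nth f (Suc n) = of_nat (Suc n) * (of_nat n + c) * fps_nth g (Suc n)"
      using arg_cong[OF f, of "\<lambda>h. fps_nth h n"] arg_cong[OF g, of "\<lambda>h. fps_nth h n"] Suc.IH
      unfolding hypergeo_op_nth by simp
    ultimately show ?case by simp
  qed (rule 0)
qed

text \<open>The binomial series of \<open>(1 - X)\<^bsup>s\<^esup>\<close> for a complex exponent \<open>s\<close>.\<close>

definition fps_one_minus_powr :: "complex \<Rightarrow> complex fps" where
  "fps_one_minus_powr s = Abs_fps (\<lambda>n. (s gchoose n) * (- 1) ^ n)"

lemma fps_deriv_one_minus_powr:
  "(1 - fps_X) * fps_deriv (fps_one_minus_powr s) = - fps_const s * fps_one_minus_powr s"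
proof (rule fps_ext)
  fix n
  show "fps_nth ((1 - fps_X) * fps_deriv (fps_one_minus_powr s)) n = fps_nth (- fps_const s * fps_one_minus_powr s) n"
  proof (cases n)
    case (Suc m)
    have "s * (s gchoose n) * (-1) ^ n
            = of_nat n * (s gchoose n) * (-1) ^ n + of_nat (Suc n) * (s gchoose Suc n) * (-1) ^ n"
      by (subst gbinomial_mult_1) (simp only: ring_distribs)
    thus ?thesis
      by (simp add: Suc fps_one_minus_powr_def algebra_simps fps_mult_left_const_nth del: of_nat_Suc)
  qed (simp add: fps_one_minus_powr_def)
qed

theorem fps_hypergeo_Euler:
  assumes c: "c \<notin> \<int>\<^sub>\<le>\<^sub>0"
  shows "fps_hypergeo [a, b] [c] 1 = fps_one_minus_powr (c - a - b) * fps_hypergeo [c - a, c - b] [c] 1"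
proof (rule hypergeo_op_unique[OF c hypergeo_op_fps_hypergeo[OF c]])
  define s where "s = c - a - b"
  define W where "W = fps_one_minus_powr s"
  define G where "G = fps_hypergeo [c - a, c - b] [c] 1"
  define C A B S where "C = fps_const c" and "A = fps_const a" and "B = fps_const b" and "S = fps_const s"
  define X :: "complex fps" where "X = fps_X"
  define W1 W2 G1 G2 where "W1 = fps_deriv W" and "W2 = fps_deriv W1" and "G1 = fps_deriv G" and "G2 = fps_deriv G1"
  have S: "S = C - A - B" by (simp add: S_def C_def A_def B_def s_def)
  \<comment> \<open>The first and second order equations for \<open>W\<close> let the derivatives of \<open>W\<close> be eliminated from
    \<open>(1 - X) * hypergeo_op a b c (W * G)\<close>; the extra factor \<open>1 - X\<close> is cancelled at the end.\<close>
  have W1: "(1 - X) * W1 = - S * W"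
    unfolding W1_def W_def X_def S_def by (rule fps_deriv_one_minus_powr)
  have "fps_deriv ((1 - X) * W1) = fps_deriv (- S * W)" by (simp only: W1)
  hence W2: "(1 - X) * W2 = (1 - S) * W1"
    by (simp add: X_def S_def W2_def flip: W1_def) (auto simp: algebra_simps simp flip: fps_const_neg)
  have k1: "fps_const (c - a + (c - b) + 1) = (C - A) + (C - B) + 1"
    and k2: "fps_const ((c - a) * (c - b)) = (C - A) * (C - B)"
    and k3: "fps_const (a + b + 1) = A + B + 1"
    and k4: "fps_const (a * b) = A * B"
    by (simp_all add: C_def A_def B_def fps_eq_iff)
  have "hypergeo_op (c - a) (c - b) c G = 0" unfolding G_def by (rule hypergeo_op_fps_hypergeo[OF c])
  hence G: "X * (1 - X) * G2 + (C - ((C - A) + (C - B) + 1) * X) * G1 - (C - A) * (C - B) * G = 0"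
    by (simp only: hypergeo_op_def k1 k2 X_def C_def A_def B_def G2_def G1_def)
  have d1: "fps_deriv (W * G) = W1 * G + W * G1"
    by (simp add: W1_def G1_def)
  have d2: "fps_deriv (W1 * G + W * G1) = W2 * G + 2 * W1 * G1 + W * G2"
    by (simp add: W2_def G2_def algebra_simps flip: W1_def G1_def)
  have "hypergeo_op a b c (W * G) = X * (1 - X) * (W2 * G + 2 * W1 * G1 + W * G2) 
          + (C - (A + B + 1) * X) * (W1 * G + W * G1) - A * B * (W * G)"
    by (simp only: hypergeo_op_def d1 d2 k3 k4 X_def C_def)
  also have "(1 - X) * \<dots> = 0"
    using W1 W2 G unfolding S by algebra
  finally have "(1 - X) * hypergeo_op a b c (W * G) = 0" .
  moreover have "1 - X \<noteq> 0" 
    using arg_cong[of "1 - X" 0 "\<lambda>h. fps_nth h 0"] by (auto simp: X_def)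
  ultimately have "hypergeo_op a b c (W * G) = 0" by simp
  thus "hypergeo_op a b c (fps_one_minus_powr (c - a - b) * fps_hypergeo [c - a, c - b] [c] 1) = 0"
    by (simp add: W_def G_def s_def)
qed (simp add: fps_one_minus_powr_def)

lemma eval_fps_one_minus_powr:
  assumes "norm z < 1"
  shows "eval_fps (fps_one_minus_powr s) z = (1 - z) powr s"
    and "ereal (norm z) < fps_conv_radius (fps_one_minus_powr s)"
proof -
  have eq: "fps_nth (fps_one_minus_powr s) n * w ^ n = (s gchoose n) * (- w) ^ n" for n w
    by (simp add: fps_one_minus_powr_def power_minus[of w])
  show "eval_fps (fps_one_minus_powr s) z = (1 - z) powr s"
    using gen_binomial_complex[of "-z" s] assms by (simp add: eval_fps_def eq sums_iff)
  have "1 \<le> fps_conv_radius (fps_one_minus_powr s)"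
    unfolding fps_conv_radius_def
  proof (rule conv_radius_geI_ex')
    fix r :: real assume "0 < r" "ereal r < 1"
    thus "summable (\<lambda>n. fps_nth (fps_one_minus_powr s) n * of_real r ^ n)"
      using gen_binomial_complex[of "- of_real r" s] unfolding eq by (simp add: sums_iff)
  qed
  thus "ereal (norm z) < fps_conv_radius (fps_one_minus_powr s)"
    using assms by (metis ereal_less(3) one_ereal_def less_ereal.simps(1) order_less_le_trans)
qed

section \<open>Ferrers functions and Gegenbauer polynomials\<close>

text \<open>
  The terminating series \<open>F(k + 2 \<mu> + 1, -k; \<mu> + 1; z)\<close> as a polynomial in \<open>z\<close>. It is the Gegenbauer
  polynomial of degree \<open>k\<close> with parameter \<open>\<mu> + 1/2\<close> in the variable \<open>1 - 2 z\<close>, normalised to have the value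
  \<open>1\<close> at \<open>z = 0\<close>; at \<open>\<mu> = -1/2\<close>, where the Gegenbauer polynomials of positive degree vanish
  identically, it is the Chebyshev polynomial of the first kind.
\<close>

definition gegenbauer_poly :: "complex \<Rightarrow> nat \<Rightarrow> complex poly" where
  "gegenbauer_poly \<mu> k = (\<Sum>j\<le>k. monom
     (pochhammer (- of_nat k) j * pochhammer (of_nat k + 2 * \<mu> + 1) j / (pochhammer (\<mu> + 1) j * fact j)) j)"

lemma coeff_gegenbauer_poly:
  "coeff (gegenbauer_poly \<mu> k) j
     = pochhammer (- of_nat k) j * pochhammer (of_nat k + 2 * \<mu> + 1) j / (pochhammer (\<mu> + 1) j * fact j)"
  by (auto simp: gegenbauer_poly_def coeff_sum pochhammer_of_nat_eq_0_iff)

lemma degree_gegenbauer_poly: "degree (gegenbauer_poly \<mu> k) \<le> k"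
  by (auto simp: gegenbauer_poly_def intro!: degree_sum_le order.trans[OF degree_monom_le])

lemma poly_eq_sum_atMost:
  fixes p :: "'a::comm_semiring_1 poly"
  assumes "degree p \<le> n"
  shows "poly p x = (\<Sum>i\<le>n. coeff p i * x ^ i)"
  unfolding poly_altdef using assms by (intro sum.mono_neutral_left) (auto simp: coeff_eq_0)

lemma hypergeo_2F1_eq_gegenbauer_poly:
  assumes "Re \<mu> > -1" "norm z < 1"
  shows "hypergeo_2F1 (- (of_nat k + \<mu>)) (of_nat k + \<mu> + 1) (\<mu> + 1) z
           = (1 - z) powr \<mu> * poly (gegenbauer_poly \<mu> k) z"
proof -
  have c: "\<mu> + 1 \<notin> \<int>\<^sub>\<le>\<^sub>0" using assms by (intro Re_pos_not_nonpos_Int) simp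
  have G: "fps_hypergeo [\<mu> + 1 - (- (of_nat k + \<mu>)), \<mu> + 1 - (of_nat k + \<mu> + 1)] [\<mu> + 1] 1
          = fps_of_poly (gegenbauer_poly \<mu> k)"
    by (rule fps_ext) (simp add: coeff_gegenbauer_poly algebra_simps)
  have s: "\<mu> + 1 - (- (of_nat k + \<mu>)) - (of_nat k + \<mu> + 1) = \<mu>" by simp
  show ?thesis
    unfolding hypergeo_2F1_eq_eval_fps fps_hypergeo_Euler[OF c, of "- (of_nat k + \<mu>)"] G s
    using eval_fps_one_minus_powr[OF assms(2), of \<mu>]
    by (subst eval_fps_mult) auto
qed

lemma Ferrers_P_mult_eq:
  assumes "Re \<mu> > -1" "0 < t" "t < 1"
  shows "Ferrers_P (of_nat k + \<mu>) (- \<mu>) (1 - 2 * t) * Ferrers_P (of_nat l + \<mu>) (- \<mu>) (1 - 2 * t)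
     = 1 / Gamma (\<mu> + 1) ^ 2 * (beta_kernel (\<mu> + 1) (\<mu> + 1) t
         * poly (gegenbauer_poly \<mu> k) (of_real t) * poly (gegenbauer_poly \<mu> l) (of_real t))"
proof -
  let ?z = "complex_of_real t"
  have P: "Ferrers_P (of_nat n + \<mu>) (- \<mu>) (1 - 2 * t) = 1 / Gamma (\<mu> + 1)
      * (complex_of_real (t / (1 - t)) powr (\<mu> / 2) * complex_of_real (1 - t) powr \<mu>) * poly (gegenbauer_poly \<mu> n) ?z" for n
  proof -
    have "(1 - (1 - 2 * t)) / (1 + (1 - 2 * t)) = t / (1 - t)" "(1 - (1 - 2 * t)) / 2 = t"
      using assms by (simp_all add: field_simps)
    moreover have "hypergeo_2F1 (- (of_nat n + \<mu>)) (of_nat n + \<mu> + 1) (\<mu> + 1) ?z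
           = (1 - ?z) powr \<mu> * poly (gegenbauer_poly \<mu> n) ?z"
      using assms by (intro hypergeo_2F1_eq_gegenbauer_poly) auto
    ultimately show ?thesis by (simp add: Ferrers_P_def)
  qed
  define w where "w = complex_of_real (t / (1 - t)) powr (\<mu> / 2) * complex_of_real (1 - t) powr \<mu>"
  have "w ^ 2 = complex_of_real t powr \<mu> * complex_of_real (1 - t) powr \<mu>"
    using assms unfolding w_def
    by (simp add: powr_def Ln_of_real ln_div power2_eq_square algebra_simps flip: exp_add del: of_real_diff of_real_divide)
       (simp add: algebra_simps flip: exp_add)
  also have "\<dots> = beta_kernel (\<mu> + 1) (\<mu> + 1) t" using assms by (simp add: beta_kernel_def)
  finally have "beta_kernel (\<mu> + 1) (\<mu> + 1) t = w ^ 2" ..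
  thus ?thesis unfolding P w_def[symmetric] by (simp add: power2_eq_square mult_ac)
qed

section \<open>Orthogonality of the Gegenbauer polynomials\<close>

lemma beta_kernel_add_left: "beta_kernel (a + of_nat j) b t = beta_kernel a b t * of_real t ^ j"
proof -
  have "complex_of_real t powr (a + of_nat j - 1) = of_real t powr (a - 1) * of_real t ^ j" if "t > 0"
    using that powr_add[of "complex_of_real t" "a - 1" "of_nat j"] by (simp add: add_diff_eq powr_nat' algebra_simps)
  thus ?thesis by (simp add: beta_kernel_def indicator_def)
qed

lemma beta_kernel_commute: "beta_kernel a b (1 - t) = beta_kernel b a t"
  by (auto simp: beta_kernel_def indicator_def)

lemma beta_kernel_add_right: "beta_kernel a (b + of_nat j) t = beta_kernel a b t * of_real (1 - t) ^ j"
  using beta_kernel_add_left[of b j a "1 - t"] by (simp only: beta_kernel_commute)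

lemma Beta_add_nat_left:
  fixes a b :: complex
  assumes "a \<notin> \<int>\<^sub>\<le>\<^sub>0" "a + b \<notin> \<int>\<^sub>\<le>\<^sub>0"
  shows "Beta (a + of_nat j) b = Beta a b * pochhammer a j / pochhammer (a + b) j"
proof -
  have "Gamma (a + b) \<noteq> 0" "Gamma a \<noteq> 0" using assms by (auto simp: Gamma_eq_zero_iff)
  thus ?thesis
    using pochhammer_Gamma[OF assms(1), of j] pochhammer_Gamma[OF assms(2), of j]
    by (simp add: Beta_def field_simps)
qed

text \<open>
  The moments against powers of \<open>1 - z\<close>, rather than of \<open>z\<close>, leave a sum with a single
  pochhammer symbol in the denominator besides the factorial, so that the Chu-Vandermonde identity suffices.
\<close>

lemma integral_beta_kernel_gegenbauer:
  assumes "Re \<mu> > -1"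
  shows "has_bochner_integral lborel
           (\<lambda>t. beta_kernel (\<mu> + 1) (\<mu> + 1 + of_nat m) t * poly (gegenbauer_poly \<mu> k) (of_real t))
           (Beta (\<mu> + 1) (\<mu> + 1 + of_nat m)
             * (pochhammer (of_nat m + 1 - of_nat k) k / pochhammer (2 * \<mu> + 2 + of_nat m) k))"
proof -
  define a b where "a = \<mu> + 1" and "b = \<mu> + 1 + of_nat m"
  define q where "q = coeff (gegenbauer_poly \<mu> k)"
  have ab: "Re a > 0" "Re b > 0" using assms by (auto simp: a_def b_def)
  have nab: "a \<notin> \<int>\<^sub>\<le>\<^sub>0" "a + b \<notin> \<int>\<^sub>\<le>\<^sub>0" using ab by (auto intro!: Re_pos_not_nonpos_Int)
  have poly: "poly (gegenbauer_poly \<mu> k) z = (\<Sum>j\<le>k. q j * z ^ j)" for z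
    unfolding q_def by (rule poly_eq_sum_atMost) (rule degree_gegenbauer_poly)
  have "has_bochner_integral lborel (\<lambda>t. \<Sum>j\<le>k. q j * beta_kernel (a + of_nat j) b t)
          (\<Sum>j\<le>k. q j * Beta (a + of_nat j) b)"
    using ab by (intro has_bochner_integral_sum has_bochner_integral_mult_right has_bochner_integral_beta_kernel) auto
  also have "(\<lambda>t. \<Sum>j\<le>k. q j * beta_kernel (a + of_nat j) b t)
               = (\<lambda>t. beta_kernel a b t * poly (gegenbauer_poly \<mu> k) (of_real t))"
    by (simp add: poly beta_kernel_add_left sum_distrib_left mult_ac)
  also have "(\<Sum>j\<le>k. q j * Beta (a + of_nat j) b) 
     = Beta a b * (\<Sum>j = 0..k. pochhammer (of_nat k + 2 * \<mu> + 1) j * pochhammer (- of_nat k) j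
                     / (of_nat (fact j) * pochhammer (a + b) j))"
    unfolding sum_distrib_left atMost_atLeast0
  proof (rule sum.cong[OF refl])
    fix j
    have "pochhammer a j \<noteq> 0" using nab by (auto simp: pochhammer_eq_0_iff dest: plus_of_nat_eq_0_imp)
    thus "q j * Beta (a + of_nat j) b = Beta a b * (pochhammer (of_nat k + 2 * \<mu> + 1) j * pochhammer (- of_nat k) j
                     / (of_nat (fact j) * pochhammer (a + b) j))"
      unfolding q_def coeff_gegenbauer_poly Beta_add_nat_left[OF nab]
      by (simp add: a_def)
  qed
  also have "(\<Sum>j = 0..k. pochhammer (of_nat k + 2 * \<mu> + 1) j * pochhammer (- of_nat k) j
                     / (of_nat (fact j) * pochhammer (a + b) j))
      = pochhammer (a + b - (of_nat k + 2 * \<mu> + 1)) k / pochhammer (a + b) k"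
    using nab by (intro Vandermonde_pochhammer) (auto dest!: plus_of_nat_eq_0_imp)
  also have "a + b - (of_nat k + 2 * \<mu> + 1) = of_nat m + 1 - of_nat k" by (simp add: a_def b_def)
  also have "a + b = 2 * \<mu> + 2 + of_nat m" by (simp add: a_def b_def)
  finally show ?thesis by (simp only: a_def b_def)
qed

lemma coeff_pcompose_one_minus:
  fixes p :: "'a::idom poly"
  assumes "degree p \<le> n"
  shows "coeff (pcompose p [:1, -1:]) n = (- 1) ^ n * coeff p n"
proof (cases "degree p = n")
  case True
  have "degree (pcompose p [:1, -1:]) = n" using True by (simp add: degree_pcompose)
  thus ?thesis using lead_coeff_comp[of "[:1, -1:]" p] True by simp
next
  case False
  thus ?thesis using assms by (simp add: coeff_eq_0 degree_pcompose)
qed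

lemma integral_gegenbauer_mult_poly:
  assumes "Re \<mu> > -1" "degree p \<le> k"
  shows "has_bochner_integral lborel
           (\<lambda>t. beta_kernel (\<mu> + 1) (\<mu> + 1) t * poly (gegenbauer_poly \<mu> k) (of_real t) * poly p (of_real t))
           ((- 1) ^ k * coeff p k * Beta (\<mu> + 1) (\<mu> + 1 + of_nat k) * fact k / pochhammer (2 * \<mu> + 2 + of_nat k) k)"
proof -
  define r where "r = pcompose p [:1, -1:]"
  define I where "I m = Beta (\<mu> + 1) (\<mu> + 1 + of_nat m)
             * (pochhammer (of_nat m + 1 - of_nat k) k / pochhammer (2 * \<mu> + 2 + of_nat m) k)" for m
  have "degree r \<le> k" using assms by (simp add: r_def degree_pcompose)
  hence r: "poly r z = (\<Sum>m\<le>k. coeff r m * z ^ m)" for z by (rule poly_eq_sum_atMost)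
  have p: "poly p z = poly r (1 - z)" for z by (simp add: r_def poly_pcompose)
  \<comment> \<open>For \<open>m < k\<close> one of the \<open>k\<close> factors \<open>m + 1 - k, ..., m\<close> of the pochhammer symbol is zero.\<close>
  have I0: "I m = 0" if "m < k" for m
  proof -
    have "(of_nat m + 1 - of_nat k :: complex) = - of_nat (k - Suc m)" using that by (simp add: of_nat_diff)
    hence "pochhammer (of_nat m + 1 - of_nat k :: complex) k = 0"
      using that by (simp only: pochhammer_of_nat_eq_0_iff)
    thus ?thesis by (simp add: I_def)
  qed
  have "has_bochner_integral lborel (\<lambda>t. \<Sum>m\<le>k. coeff r m * 
         (beta_kernel (\<mu> + 1) (\<mu> + 1 + of_nat m) t * poly (gegenbauer_poly \<mu> k) (of_real t)))
         (\<Sum>m\<le>k. coeff r m * I m)"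
    unfolding I_def by (intro has_bochner_integral_sum has_bochner_integral_mult_right integral_beta_kernel_gegenbauer assms)
  also have "(\<lambda>t. \<Sum>m\<le>k. coeff r m * 
         (beta_kernel (\<mu> + 1) (\<mu> + 1 + of_nat m) t * poly (gegenbauer_poly \<mu> k) (of_real t))) 
     = (\<lambda>t. beta_kernel (\<mu> + 1) (\<mu> + 1) t * poly (gegenbauer_poly \<mu> k) (of_real t) * poly p (of_real t))"
    by (simp add: p r beta_kernel_add_right sum_distrib_left mult_ac)
  also have "(\<Sum>m\<le>k. coeff r m * I m) = coeff r k * I k"
    by (subst sum.remove[of _ k]) (auto intro!: sum.neutral I0)
  also have "I k = Beta (\<mu> + 1) (\<mu> + 1 + of_nat k) * fact k / pochhammer (2 * \<mu> + 2 + of_nat k) k"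
    by (simp add: I_def pochhammer_fact)
  also have "coeff r k = (- 1) ^ k * coeff p k"
    unfolding r_def by (rule coeff_pcompose_one_minus) fact
  finally show ?thesis by (simp add: mult_ac)
qed

lemma gegenbauer_orthogonal:
  assumes "Re \<mu> > -1" "l < k"
  shows "has_bochner_integral lborel
           (\<lambda>t. beta_kernel (\<mu> + 1) (\<mu> + 1) t * poly (gegenbauer_poly \<mu> k) (of_real t) * poly (gegenbauer_poly \<mu> l) (of_real t)) 0"
proof -
  have "degree (gegenbauer_poly \<mu> l) < k" using degree_gegenbauer_poly[of \<mu> l] assms(2) by simp
  thus ?thesis using integral_gegenbauer_mult_poly[OF assms(1), of "gegenbauer_poly \<mu> l" k]
    by (simp add: coeff_eq_0)
qed

text \<open>
  The hypothesis \<open>k \<ge> 1\<close> keeps \<open>2 \<mu> + k + 1\<close> away from the poles of the Gamma function. For \<open>k = 0\<close>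
  and \<open>\<mu> = -1/2\<close> the denominator on the right-hand side would be of the form \<open>\<infinity> * 0\<close>.
\<close>

lemma gegenbauer_norm:
  assumes "Re \<mu> > -1" "k \<ge> 1"
  shows "has_bochner_integral lborel
           (\<lambda>t. beta_kernel (\<mu> + 1) (\<mu> + 1) t * poly (gegenbauer_poly \<mu> k) (of_real t) * poly (gegenbauer_poly \<mu> k) (of_real t))
           (Gamma (\<mu> + 1) ^ 2 * fact k / (Gamma (2 * \<mu> + of_nat k + 1) * (2 * (\<mu> + of_nat k + 1 / 2))))"
proof -
  define c where "c = 2 * \<mu> + of_nat k + 1"
  have Re: "Re \<mu> + real k > 0" using assms by (cases k) auto
  have n: "\<mu> + 1 \<notin> \<int>\<^sub>\<le>\<^sub>0" "c \<notin> \<int>\<^sub>\<le>\<^sub>0" "c + 1 \<notin> \<int>\<^sub>\<le>\<^sub>0" "c + of_nat k \<notin> \<int>\<^sub>\<le>\<^sub>0"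
    using assms Re by (auto intro!: Re_pos_not_nonpos_Int simp: c_def)
  have nz: "c + of_nat k \<noteq> 0" "Gamma (\<mu> + 1) \<noteq> 0" "Gamma c \<noteq> 0" "Gamma (c + 1) \<noteq> 0" "Gamma (c + of_nat k) \<noteq> 0"
     using n by (auto simp: Gamma_eq_zero_iff)
  have p1: "pochhammer (\<mu> + 1) k = Gamma (\<mu> + 1 + of_nat k) / Gamma (\<mu> + 1)"
   and p2: "pochhammer c k = Gamma (c + of_nat k) / Gamma c"
   and p3: "pochhammer (c + 1) k = Gamma (c + 1 + of_nat k) / Gamma (c + 1)"
    using n by (simp_all add: pochhammer_Gamma)
  have g: "Gamma (\<mu> + 1 + of_nat k) \<noteq> 0"
    using assms Re_pos_not_nonpos_Int[of "\<mu> + 1 + of_nat k"] by (simp add: Gamma_eq_zero_iff)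
  have g3: "Gamma (c + 1 + of_nat k) = (c + of_nat k) * Gamma (c + of_nat k)"
    using Gamma_plus1[of "c + of_nat k"] n by (simp add: add_ac)
  have lead: "(- 1) ^ k * coeff (gegenbauer_poly \<mu> k) k = pochhammer c k / pochhammer (\<mu> + 1) k"
    by (simp add: coeff_gegenbauer_poly pochhammer_same c_def add_ac)
  have B: "Beta (\<mu> + 1) (\<mu> + 1 + of_nat k) = Gamma (\<mu> + 1) * Gamma (\<mu> + 1 + of_nat k) / Gamma (c + 1)"
    by (simp add: Beta_def c_def algebra_simps)
  have "(- 1) ^ k * coeff (gegenbauer_poly \<mu> k) k * Beta (\<mu> + 1) (\<mu> + 1 + of_nat k) * fact k 
      / pochhammer (2 * \<mu> + 2 + of_nat k) k = 
     pochhammer c k / pochhammer (\<mu> + 1) k * (Gamma (\<mu> + 1) * Gamma (\<mu> + 1 + of_nat k) / Gamma (c + 1)) * fact k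
      / pochhammer (c + 1) k"
    unfolding lead B by (simp add: c_def add_ac)
  also have "\<dots> = Gamma (\<mu> + 1) ^ 2 * fact k / (Gamma c * (c + of_nat k))"
    unfolding p1 p2 p3 g3 using nz g by (simp add: power2_eq_square)
  also have "c + of_nat k = 2 * (\<mu> + of_nat k + 1 / 2)" by (simp add: c_def)
  finally show ?thesis
    using integral_gegenbauer_mult_poly[OF assms(1) degree_gegenbauer_poly[of \<mu> k]]
    by (simp only: c_def)
qed

section \<open>The integral of a product of Ferrers functions\<close>

lemma has_bochner_integral_Ioo_affine:
  fixes f :: "real \<Rightarrow> complex"
  assumes "has_bochner_integral lborel (\<lambda>t. indicator {0<..<1} t *\<^sub>R f (1 - 2 * t)) I"
  shows "set_integrable lborel {-1<..<1} f" "(LINT x:{-1<..<1}|lborel. f x) = 2 * I"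
proof -
  have eq: "indicator {-1<..<1} (1 + (-2) * t) *\<^sub>R f (1 + (-2) * t) = indicator {0<..<1} t *\<^sub>R f (1 - 2 * t)" for t
    by (cases "0 < t"; cases "t < 1") simp_all
  show "set_integrable lborel {-1<..<1} f"
    using assms lborel_integrable_real_affine_iff[of "-2" "\<lambda>x. indicator {-1<..<1} x *\<^sub>R f x" 1]
    unfolding set_integrable_def eq by (simp add: has_bochner_integral_iff)
  show "(LINT x:{-1<..<1}|lborel. f x) = 2 * I"
    using assms unfolding set_lebesgue_integral_def
    by (subst lborel_integral_real_affine[of "-2" _ 1], simp)
       (simp only: eq, simp add: has_bochner_integral_iff scaleR_conv_of_real)
qed

theorem theorem2p1:
  fixes \<mu> :: complex and k k' :: nat
  assumes "k \<ge> 1" and "k' \<ge> 1"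
    and "\<mu> + of_nat k + 1 / 2 \<noteq> 0"
    and "Re \<mu> > - 1"
  shows "set_integrable lborel {-1<..<1}
           (\<lambda>x. Ferrers_P (of_nat k + \<mu>) (- \<mu>) x * Ferrers_P (of_nat k' + \<mu>) (- \<mu>) x)
       \<and> (LINT x:{-1<..<1}|lborel.
            Ferrers_P (of_nat k + \<mu>) (- \<mu>) x * Ferrers_P (of_nat k' + \<mu>) (- \<mu>) x)
         = fact k / (Gamma (2 * \<mu> + of_nat k + 1) * (\<mu> + of_nat k + 1 / 2))
           * (if k = k' then 1 else 0)"
proof -
  define I where "I = (if k = k' then Gamma (\<mu> + 1) ^ 2 * fact k
      / (Gamma (2 * \<mu> + of_nat k + 1) * (2 * (\<mu> + of_nat k + 1 / 2))) else 0)"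
  let ?P = "\<lambda>x. Ferrers_P (of_nat k + \<mu>) (- \<mu>) x * Ferrers_P (of_nat k' + \<mu>) (- \<mu>) x"
  let ?h = "\<lambda>t. beta_kernel (\<mu> + 1) (\<mu> + 1) t
              * poly (gegenbauer_poly \<mu> k) (of_real t) * poly (gegenbauer_poly \<mu> k') (of_real t)"
  have "has_bochner_integral lborel ?h I"
  proof (cases k k' rule: linorder_cases)
    case less
    thus ?thesis using gegenbauer_orthogonal[OF assms(4) less] by (simp add: I_def mult_ac)
  next
    case equal
    thus ?thesis using gegenbauer_norm[OF assms(4,1)] by (simp add: I_def)
  next
    case greater
    thus ?thesis using gegenbauer_orthogonal[OF assms(4) greater] by (simp add: I_def)
  qed
  hence "has_bochner_integral lborel (\<lambda>t. 1 / Gamma (\<mu> + 1) ^ 2 * ?h t) (1 / Gamma (\<mu> + 1) ^ 2 * I)"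
    by (intro has_bochner_integral_mult_right) auto
  also have "(\<lambda>t. 1 / Gamma (\<mu> + 1) ^ 2 * ?h t) = (\<lambda>t. indicator {0<..<1} t *\<^sub>R ?P (1 - 2 * t))"
  proof
    fix t :: real
    show "1 / Gamma (\<mu> + 1) ^ 2 * ?h t = indicator {0<..<1} t *\<^sub>R ?P (1 - 2 * t)"
    proof (cases "0 < t \<and> t < 1")
      case True
      thus ?thesis using Ferrers_P_mult_eq[OF assms(4), of t k k'] by simp
    qed (auto simp: beta_kernel_def)
  qed
  finally have main: "has_bochner_integral lborel (\<lambda>t. indicator {0<..<1} t *\<^sub>R ?P (1 - 2 * t))
      (1 / Gamma (\<mu> + 1) ^ 2 * I)" .
  have "Gamma (\<mu> + 1) \<noteq> 0"
    using Re_pos_not_nonpos_Int[of "\<mu> + 1"] assms(4) by (simp add: Gamma_eq_zero_iff)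
  moreover have "2 * (1 / g ^ 2 * (g ^ 2 * f / (G * (2 * d)))) = f / (G * d)" if "g \<noteq> 0" for g f G d :: complex
    using that by simp
  ultimately have "2 * (1 / Gamma (\<mu> + 1) ^ 2 * I)
      = fact k / (Gamma (2 * \<mu> + of_nat k + 1) * (\<mu> + of_nat k + 1 / 2)) * (if k = k' then 1 else 0)"
    unfolding I_def by (cases "k = k'") (simp_all only: if_True if_False mult_1_right mult_zero_right refl)
  with has_bochner_integral_Ioo_affine[OF main] show ?thesis by (simp only: simp_thms)
qed

end
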